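(* Let $M$ be a special monoid given by a finite presentation $\langle A\mid w_1=1,w_2=1,\dots,w_k=1\rangle$. Let $\mathcal{C}$ be a super-AFL closed under reversal. Then the following are equivalent: (i) $M$ has word problem in $\mathcal{C}$. (ii) For every word $w\in A^*$, the language $\mathrm{Rep}_A^M(w)=\{u\in A^*\mid u=_M w\}$ is in $\mathcal{C}$. (iii) The language $\mathrm{IP}_A^M=\{w\in A^*\mid w=_M 1\}$ is in $\mathcal{C}$.
   Context: Presentations are monoid presentations and $A$ is finite. $u=_M v$ means that $u,v\in A^*$ represent the same element of $M$. Word problem: for a word $w=a_1a_2\cdots a_n$, $w^{\mathrm{rev}}=a_n\cdots a_2a_1$. For a monoid $M$ generated (as a monoid) by a finite set $A$, let $\mathrm{WP}_A^M=\{u\# v^{\mathrm{rev}} \mid u,v\in A^*,\ u=_M v\}$, where $\#\notin A$. $M$ has word problem in $\mathcal{C}$ if $\mathrm{WP}_A^M\in\mathcal{C}$; if $\mathcal{C}$ is closed under inverse homomorphism this does not depend on the choice of finite generating set $A$. Super-AFL: a class $\mathcal{C}$ of languages (over finite alphabets) is an AFL if it is closed under homomorphism, inverse homomorphism, intersection with regular languages, union, concatenation, and Kleene star. It is a super-AFL if in addition it is closed under nested iterated substitution, defined as follows. A $\mathcal{C}$-substitution $\sigma$ on a finite alphabet $A$ assigns to each $a\in A$ a language $\sigma(a)\in\mathcal{C}$ (over any finite alphabet), extended by $\sigma(xy)=\sigma(x)\sigma(y)$ and $\sigma(L)=\bigcup_{w\in L}\sigma(w)$. Let $A_a$ be the smallest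 finite alphabet with $\sigma(a)\subseteq A_a^*$, and extend $\sigma$ to $A\cup\bigcup_a A_a$ by $\sigma(b)=\{b\}$ for $b\in(\bigcup_a A_a)\setminus A$. Put $\sigma^0(L)=L$, $\sigma^{n+1}(L)=\sigma(\sigma^n(L))$, $\sigma^\infty(L)=\bigcup_{n\ge0}\sigma^n(L)$. The iterated substitution $\sigma^\infty$ is nested if $b\in\sigma(b)$ for every $b\in A\cup\bigcup_a A_a$. $\mathcal{C}$ is closed under nested iterated substitution if $\sigma^\infty(L)\in\mathcal{C}$ for every $\mathcal{C}$-substitution $\sigma$ on $A$ with $\sigma^\infty$ nested and every $L\in\mathcal{C}$, $L\subseteq A^*$. $\mathcal{C}$ is closed under reversal if $L\in\mathcal{C}$ implies $\{w^{\mathrm{rev}}\mid w\in L\}\in\mathcal{C}$. *)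

theory Defs
  imports "HOL-Algebra.Group"
begin

text \<open>Words are lists and a language is a set of words.  All finite alphabets are finite subsets of
  one ambient type of symbols, which is assumed to be infinite where this matters; a class of
  languages is a set of languages over finite subsets of that type.\<close>

section \<open>Languages\<close>

definition conc :: "'a list set \<Rightarrow> 'a list set \<Rightarrow> 'a list set" where
  "conc K L = {u @ v | u v. u \<in> K \<and> v \<in> L}"

definition kleene_star :: "'a list set \<Rightarrow> 'a list set" where
  "kleene_star L = {concat us | us. set us \<subseteq> L}"

text \<open>The smallest alphabet over which a language lives.\<close>

definition alphabet :: "'a list set \<Rightarrow> 'a set" where
  "alphabet L = (\<Union>w\<in>L. set w)"

text \<open>A homomorphism of free monoids is given by its values on letters.\<close>

definition hom_word :: "('a \<Rightarrow> 'b list) \<Rightarrow> 'a list \<Rightarrow> 'b list" where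
  "hom_word \<phi> w = concat (map \<phi> w)"

text \<open>Regularity is recognizability by a complete deterministic finite automaton over a finite
  alphabet.  States may be taken to be natural numbers without loss of generality.\<close>

definition regular :: "'a list set \<Rightarrow> bool" where
  "regular L \<longleftrightarrow> (\<exists>\<Sigma> (Q :: nat set) \<delta> q\<^sub>0 F.
     finite \<Sigma> \<and> finite Q \<and> q\<^sub>0 \<in> Q \<and> F \<subseteq> Q \<and>
     (\<forall>q\<in>Q. \<forall>a\<in>\<Sigma>. \<delta> q a \<in> Q) \<and>
     L = {w \<in> lists \<Sigma>. foldl \<delta> q\<^sub>0 w \<in> F})"

section \<open>Substitutions\<close>

primrec subst_word :: "('a \<Rightarrow> 'a list set) \<Rightarrow> 'a list \<Rightarrow> 'a list set" where
  "subst_word \<sigma> [] = {[]}"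
| "subst_word \<sigma> (a # w) = conc (\<sigma> a) (subst_word \<sigma> w)"

definition subst_lang :: "('a \<Rightarrow> 'a list set) \<Rightarrow> 'a list set \<Rightarrow> 'a list set" where
  "subst_lang \<sigma> L = (\<Union>w\<in>L. subst_word \<sigma> w)"

text \<open>A substitution on \<open>A\<close> is a function of which only the values on \<open>A\<close> matter.
  \<open>subst_ext A \<sigma>\<close> extends it by \<open>b \<mapsto> {b}\<close> to the letters of \<open>\<Union>a\<in>A. alphabet (\<sigma> a)\<close> outside \<open>A\<close>;
  its values on further letters play no role when it is iterated on a language over \<open>A\<close>.\<close>

definition subst_ext :: "'a set \<Rightarrow> ('a \<Rightarrow> 'a list set) \<Rightarrow> 'a \<Rightarrow> 'a list set" where
  "subst_ext A \<sigma> b = (if b \<in> A then \<sigma> b else {[b]})"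

definition iter_subst :: "'a set \<Rightarrow> ('a \<Rightarrow> 'a list set) \<Rightarrow> 'a list set \<Rightarrow> 'a list set" where
  "iter_subst A \<sigma> L = (\<Union>n. (subst_lang (subst_ext A \<sigma>) ^^ n) L)"

definition nested_subst :: "'a set \<Rightarrow> ('a \<Rightarrow> 'a list set) \<Rightarrow> bool" where
  "nested_subst A \<sigma> \<longleftrightarrow> (\<forall>b \<in> A \<union> (\<Union>a\<in>A. alphabet (\<sigma> a)). [b] \<in> subst_ext A \<sigma> b)"

section \<open>Classes of languages\<close>

text \<open>In the closure under inverse homomorphism the finite domain alphabet \<open>\<Sigma>\<close> has to be explicit,
  as it determines the preimage; in the closure under homomorphism it is irrelevant.\<close>

definition AFL :: "'a list set set \<Rightarrow> bool" where
  "AFL C \<longleftrightarrow>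
     (\<forall>L\<in>C. finite (alphabet L)) \<and>
     (\<forall>L\<in>C. \<forall>\<phi>. hom_word \<phi> ` L \<in> C) \<and>
     (\<forall>L\<in>C. \<forall>\<phi> \<Sigma>. finite \<Sigma> \<longrightarrow> {w \<in> lists \<Sigma>. hom_word \<phi> w \<in> L} \<in> C) \<and>
     (\<forall>L\<in>C. \<forall>K. regular K \<longrightarrow> L \<inter> K \<in> C) \<and>
     (\<forall>K\<in>C. \<forall>L\<in>C. K \<union> L \<in> C) \<and>
     (\<forall>K\<in>C. \<forall>L\<in>C. conc K L \<in> C) \<and>
     (\<forall>L\<in>C. kleene_star L \<in> C)"

definition closed_nested_iter_subst :: "'a list set set \<Rightarrow> bool" where
  "closed_nested_iter_subst C \<longleftrightarrow>
     (\<forall>A \<sigma> L. finite A \<longrightarrow> (\<forall>a\<in>A. \<sigma> a \<in> C) \<longrightarrow> nested_subst A \<sigma> \<longrightarrow>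
        L \<in> C \<longrightarrow> L \<subseteq> lists A \<longrightarrow> iter_subst A \<sigma> L \<in> C)"

definition super_AFL :: "'a list set set \<Rightarrow> bool" where
  "super_AFL C \<longleftrightarrow> AFL C \<and> closed_nested_iter_subst C"

definition closed_reversal :: "'a list set set \<Rightarrow> bool" where
  "closed_reversal C \<longleftrightarrow> (\<forall>L\<in>C. rev ` L \<in> C)"

section \<open>Monoid presentations\<close>

text \<open>The least congruence on the free monoid over \<open>A\<close> that contains \<open>R\<close>.\<close>

inductive pres_cong :: "'a set \<Rightarrow> ('a list \<times> 'a list) set \<Rightarrow> 'a list \<Rightarrow> 'a list \<Rightarrow> bool"
  for A R where
  base: "(u, v) \<in> R \<Longrightarrow> pres_cong A R u v"
| refl: "u \<in> lists A \<Longrightarrow> pres_cong A R u u"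
| sym: "pres_cong A R u v \<Longrightarrow> pres_cong A R v u"
| trans: "pres_cong A R u v \<Longrightarrow> pres_cong A R v w \<Longrightarrow> pres_cong A R u w"
| append: "pres_cong A R u v \<Longrightarrow> pres_cong A R u' v' \<Longrightarrow> pres_cong A R (u @ u') (v @ v')"

text \<open>The element of a monoid \<open>M\<close> that is represented by a word, where \<open>\<pi> a\<close> is the generator
  corresponding to the letter \<open>a\<close>.\<close>

definition word_val :: "('m, 'x) monoid_scheme \<Rightarrow> ('a \<Rightarrow> 'm) \<Rightarrow> 'a list \<Rightarrow> 'm" where
  "word_val M \<pi> w = foldr (\<lambda>a x. \<pi> a \<otimes>\<^bsub>M\<^esub> x) w \<one>\<^bsub>M\<^esub>"

text \<open>\<open>M\<close> is, via \<open>\<pi>\<close>, the monoid presented by \<open>\<langle>A | R\<rangle>\<close>: the map from words to elements is onto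
  and its kernel is the congruence generated by \<open>R\<close>.\<close>

definition presented_by ::
  "('m, 'x) monoid_scheme \<Rightarrow> ('a \<Rightarrow> 'm) \<Rightarrow> 'a set \<Rightarrow> ('a list \<times> 'a list) set \<Rightarrow> bool" where
  "presented_by M \<pi> A R \<longleftrightarrow>
     monoid M \<and> R \<subseteq> lists A \<times> lists A \<and> \<pi> ` A \<subseteq> carrier M \<and>
     word_val M \<pi> ` lists A = carrier M \<and>
     (\<forall>u\<in>lists A. \<forall>v\<in>lists A. word_val M \<pi> u = word_val M \<pi> v \<longleftrightarrow> pres_cong A R u v)"

definition special_rels :: "'a list list \<Rightarrow> ('a list \<times> 'a list) set" where
  "special_rels ws = {(w, []) | w. w \<in> set ws}"

section \<open>Languages of a generated monoid\<close>

text \<open>The separator \<open>h\<close> is meant to lie outside \<open>A\<close>.\<close>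

definition WP :: "('m, 'x) monoid_scheme \<Rightarrow> ('a \<Rightarrow> 'm) \<Rightarrow> 'a set \<Rightarrow> 'a \<Rightarrow> 'a list set" where
  "WP M \<pi> A h =
     {u @ [h] @ rev v | u v. u \<in> lists A \<and> v \<in> lists A \<and> word_val M \<pi> u = word_val M \<pi> v}"

definition Rep :: "('m, 'x) monoid_scheme \<Rightarrow> ('a \<Rightarrow> 'm) \<Rightarrow> 'a set \<Rightarrow> 'a list \<Rightarrow> 'a list set" where
  "Rep M \<pi> A w = {u \<in> lists A. word_val M \<pi> u = word_val M \<pi> w}"

definition IP :: "('m, 'x) monoid_scheme \<Rightarrow> ('a \<Rightarrow> 'm) \<Rightarrow> 'a set \<Rightarrow> 'a list set" where
  "IP M \<pi> A = {w \<in> lists A. word_val M \<pi> w = \<one>\<^bsub>M\<^esub>}"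

end

theory Submission imports Defs "HOL-Library.Sublist" begin

text \<open>The substantial implication is from (iii) to (i).  If two invertible words overlap, then the
  overlap, the two remainders and the union are invertible.  As the relators are invertible,
  inserting or deleting one changes neither the values of the invertible factors of a word nor the
  letters between them.  Two consequences follow.  First, \<open>u\<close> and \<open>v\<close> represent the same element iff
  \<open>u = u\<^sub>0 a\<^sub>1 u\<^sub>1 \<dots> a\<^sub>n u\<^sub>n\<close> and \<open>v = v\<^sub>0 a\<^sub>1 v\<^sub>1 \<dots> a\<^sub>n v\<^sub>n\<close> where \<open>u\<^sub>i\<close> and \<open>v\<^sub>i\<close> represent the same unit.
  Second, every minimal invertible factor of an invertible word has the value of an invertible factor
  of a relator.

  Hence the word problem is the part over \<open>A \<union> {#}\<close> of the nested iterated substitution that sends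
  \<open>#\<close> to \<open>#\<close>, to \<open>a # a\<close>, and to \<open>u # x\<^sub>m \<dots> x\<^sub>1\<close> where \<open>u\<close> represents the product of the units named by
  the fresh letters \<open>x\<^sub>1, \<dots>, x\<^sub>m\<close>, and sends a fresh letter to itself and to the reversals of the words
  that represent its unit.  All these languages come from the identity problem, because every unit
  involved is inverted by a fixed word.\<close>

section \<open>Languages\<close>

text \<open>The condition on \<open>k\<close> makes the cases exclusive: cuts at the same position
  fall under \<open>le\<close>, and the overlaps in \<open>gt\<close> are proper.\<close>

lemma append_eq_cases [consumes 1, case_names le gt]:
  assumes "a @ b = c @ d"
  obtains k where "c = a @ k" "b = k @ d" | k where "a = c @ k" "d = k @ b" "k \<noteq> []"
proof -
  from assms consider k where "a = c @ k" "d = k @ b" | k where "c = a @ k" "b = k @ d"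
    unfolding append_eq_append_conv2 by blast
  then show thesis
  proof cases
    case (1 k)
    then show thesis using that by (cases "k = []") auto
  qed (rule that)
qed

lemma hom_word_Nil [simp]: "hom_word \<phi> [] = []"
  and hom_word_Cons [simp]: "hom_word \<phi> (a # w) = \<phi> a @ hom_word \<phi> w"
  and hom_word_append [simp]: "hom_word \<phi> (u @ v) = hom_word \<phi> u @ hom_word \<phi> v"
  by (simp_all add: hom_word_def)

lemma hom_word_cong: "(\<And>a. a \<in> set w \<Longrightarrow> \<phi> a = \<psi> a) \<Longrightarrow> hom_word \<phi> w = hom_word \<psi> w"
  by (induction w) auto

lemma hom_word_id: "(\<And>a. a \<in> set w \<Longrightarrow> \<phi> a = [a]) \<Longrightarrow> hom_word \<phi> w = w"
  by (induction w) auto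

section \<open>Consequences of the closure properties of an AFL\<close>

lemma AFL_hom: "AFL C \<Longrightarrow> L \<in> C \<Longrightarrow> hom_word \<phi> ` L \<in> C"
  by (simp add: AFL_def)

lemma AFL_inverse_hom:
  "AFL C \<Longrightarrow> L \<in> C \<Longrightarrow> finite \<Sigma> \<Longrightarrow> {w \<in> lists \<Sigma>. hom_word \<phi> w \<in> L} \<in> C"
  by (simp add: AFL_def)

lemma AFL_regular: "AFL C \<Longrightarrow> L \<in> C \<Longrightarrow> regular K \<Longrightarrow> L \<inter> K \<in> C"
  by (simp add: AFL_def)

lemma AFL_union: "AFL C \<Longrightarrow> K \<in> C \<Longrightarrow> L \<in> C \<Longrightarrow> K \<union> L \<in> C"
  by (simp add: AFL_def)

text \<open>The domain alphabet of an inverse homomorphism is explicit, so the preimage under the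
  identity is already the restriction.\<close>

lemma AFL_restrict:
  assumes "AFL C" "L \<in> C" "finite \<Sigma>"
  shows "L \<inter> lists \<Sigma> \<in> C"
proof -
  have "L \<inter> lists \<Sigma> = {w \<in> lists \<Sigma>. hom_word (\<lambda>a. [a]) w \<in> L}"
    by (auto simp: hom_word_id)
  then show ?thesis
    using AFL_inverse_hom[OF assms, of "\<lambda>a. [a]"] by simp
qed

text \<open>The only regular filter of the development. With \<open>X = {}\<close> the letter
  \<open>h\<close> becomes an end marker.\<close>

definition split_at :: "'a set \<Rightarrow> 'a \<Rightarrow> 'a set \<Rightarrow> 'a list set" where
  "split_at A h X = {u @ [h] @ y | u y. u \<in> lists A \<and> y \<in> lists X}"

lemma split_atI: "u \<in> lists A \<Longrightarrow> y \<in> lists X \<Longrightarrow> u @ [h] @ y \<in> split_at A h X"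
  unfolding split_at_def by blast

lemma split_at_Cons:
  assumes "h \<notin> A"
  shows "c # w \<in> split_at A h X \<longleftrightarrow> c \<in> A \<and> w \<in> split_at A h X \<or> c = h \<and> w \<in> lists X"
proof
  assume "c # w \<in> split_at A h X"
  then obtain u y where *: "c # w = u @ [h] @ y" "u \<in> lists A" "y \<in> lists X"
    unfolding split_at_def by blast
  show "c \<in> A \<and> w \<in> split_at A h X \<or> c = h \<and> w \<in> lists X"
  proof (cases u)
    case Nil
    then show ?thesis using * by simp
  next
    case (Cons b u')
    then show ?thesis using * split_atI[of u' A y X h] by simp
  qed
next
  assume "c \<in> A \<and> w \<in> split_at A h X \<or> c = h \<and> w \<in> lists X"
  then show "c # w \<in> split_at A h X"
  proof
    assume *: "c \<in> A \<and> w \<in> split_at A h X"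
    then obtain u y where "w = u @ [h] @ y" "u \<in> lists A" "y \<in> lists X"
      unfolding split_at_def by blast
    then show ?thesis using * split_atI[of "c # u" A y X h] by simp
  next
    assume "c = h \<and> w \<in> lists X"
    then show ?thesis using split_atI[of "[]" A w X h] by simp
  qed
qed

lemma regularI:
  fixes Q :: "nat set"
  assumes "finite \<Sigma>" "finite Q" "q\<^sub>0 \<in> Q" "F \<subseteq> Q"
    and "\<And>q a. q \<in> Q \<Longrightarrow> a \<in> \<Sigma> \<Longrightarrow> \<delta> q a \<in> Q"
    and "L = {w \<in> lists \<Sigma>. foldl \<delta> q\<^sub>0 w \<in> F}"
  shows "regular L"
  unfolding regular_def
  by (rule exI[of _ \<Sigma>], rule exI[of _ Q], rule exI[of _ \<delta>], rule exI[of _ q\<^sub>0],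
      rule exI[of _ F]) (intro conjI ballI assms)

lemma regular_split_at:
  assumes "finite A" "finite X" "h \<notin> A"
  shows "regular (split_at A h X)"
proof -
  \<comment> \<open>State 0 is before the separator, state 1 after it, and state 2 is a
    sink.\<close>
  define \<delta> :: "nat \<Rightarrow> 'a \<Rightarrow> nat" where
    "\<delta> q c = (if q = 0 then if c \<in> A then 0 else if c = h then 1 else 2
              else if q = 1 \<and> c \<in> X then 1 else 2)" for q c
  have 2: "foldl \<delta> 2 w = 2" for w
    by (induction w) (auto simp: \<delta>_def)
  have 1: "foldl \<delta> 1 w = 1 \<longleftrightarrow> w \<in> lists X" for w
  proof (induction w)
    case (Cons c w)
    have "\<delta> 1 c = (if c \<in> X then 1 else 2)" by (simp add: \<delta>_def)
    then show ?case using 2 Cons by simp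
  qed simp
  have 0: "foldl \<delta> 0 w = 1 \<longleftrightarrow> w \<in> split_at A h X" for w
  proof (induction w)
    case Nil
    then show ?case by (simp add: split_at_def)
  next
    case (Cons c w)
    consider "c \<in> A" | "c = h" "c \<notin> A" | "c \<notin> A" "c \<noteq> h" by blast
    then show ?case
    proof cases
      case 1
      then have "\<delta> 0 c = 0" by (simp add: \<delta>_def)
      then show ?thesis using Cons assms(3) 1 by (auto simp: split_at_Cons)
    next
      case c: 2
      then have "\<delta> 0 c = 1" by (simp add: \<delta>_def)
      then show ?thesis using c 1 assms(3) by (simp add: split_at_Cons)
    next
      case c: 3
      then have "\<delta> 0 c = 2" by (simp add: \<delta>_def)
      then show ?thesis using c 2 assms(3) by (simp add: split_at_Cons)
    qed
  qed
  show ?thesis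
  proof (rule regularI)
    show "split_at A h X = {w \<in> lists (insert h (A \<union> X)). foldl \<delta> 0 w \<in> {1}}"
      unfolding singleton_iff 0 by (auto simp: split_at_def)
    show "\<delta> q a \<in> {0, 1, 2}" if "q \<in> {0, 1, 2}" for q a
      by (simp add: \<delta>_def)
  qed (use assms in simp_all)
qed

text \<open>An end marker \<open>h\<close> stands for the word to be removed: one homomorphism
  writes \<open>w\<close> for it, the regular filter forces exactly one marker at the end, and a
  second homomorphism erases it.\<close>

lemma AFL_right_quotient:
  assumes "AFL C" "L \<in> C" "finite A" "h \<notin> A"
  shows "{u \<in> lists A. u @ w \<in> L} \<in> C"
proof -
  let ?\<phi> = "\<lambda>c. if c = h then w else [c]" and ?\<psi> = "\<lambda>c. if c = h then [] else [c]"
  let ?N = "{z \<in> lists (insert h A). hom_word ?\<phi> z \<in> L} \<inter> split_at A h {}"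
  have id: "hom_word ?\<phi> u = u" "hom_word ?\<psi> u = u" if "u \<in> lists A" for u
    using that assms(4) by (auto intro!: hom_word_id)
  have "hom_word ?\<psi> ` ?N = {u \<in> lists A. u @ w \<in> L}"
  proof (intro subset_antisym subsetI)
    fix u assume "u \<in> hom_word ?\<psi> ` ?N"
    then obtain z where z: "u = hom_word ?\<psi> z" "hom_word ?\<phi> z \<in> L" "z \<in> split_at A h {}"
      by blast
    then obtain v where "z = v @ [h]" "v \<in> lists A"
      unfolding split_at_def by auto
    with z(1,2) show "u \<in> {u \<in> lists A. u @ w \<in> L}"
      using id by simp
  next
    fix u assume u: "u \<in> {u \<in> lists A. u @ w \<in> L}"
    then have "u @ [h] \<in> ?N"
      using id split_atI[of u A "[]" "{}" h] by auto
    moreover have "u = hom_word ?\<psi> (u @ [h])"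
      using u id by simp
    ultimately show "u \<in> hom_word ?\<psi> ` ?N" by (rule rev_image_eqI)
  qed
  moreover have "hom_word ?\<psi> ` ?N \<in> C"
    using assms regular_split_at[of A "{}" h]
    by (intro AFL_hom[OF assms(1)] AFL_regular[OF assms(1)] AFL_inverse_hom[OF assms(1)]) simp_all
  ultimately show ?thesis by simp
qed

text \<open>By its definition an AFL may be empty, so a member containing the empty word is
  supplied, later the identity problem. The erasing homomorphism maps all of
  \<open>lists {b}\<close> into \<open>L\<close>, and the filter picks one word.\<close>

lemma AFL_letter:
  assumes "AFL C" "L \<in> C" "[] \<in> L"
  shows "{[b]} \<in> C"
proof -
  have "{w \<in> lists {b}. hom_word (\<lambda>_. []) w \<in> L} = lists {b}"
    using assms(3) by (simp add: hom_word_def concat_eq_Nil_conv[THEN iffD2])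
  then have "lists {b} \<in> C"
    using AFL_inverse_hom[OF assms(1,2), of "{b}" "\<lambda>_. []"] by simp
  moreover have "{[b]} = lists {b} \<inter> split_at {} b {}"
    by (auto simp: split_at_def)
  ultimately show ?thesis
    using AFL_regular[OF assms(1) _ regular_split_at[of "{}" "{}" b]] by simp
qed

lemma AFL_word:
  assumes "AFL C" "L \<in> C" "[] \<in> L"
  shows "{w} \<in> C"
  using AFL_hom[OF assms(1) AFL_letter[OF assms], of "\<lambda>_. w"] by simp

lemma AFL_finite_union:
  assumes "AFL C" "L \<in> C" "[] \<in> L" "finite F" "K \<in> C"
  shows "F \<union> K \<in> C"
  using assms(4)
  by (induction F) (use assms(5) AFL_union[OF assms(1) AFL_word[OF assms(1-3)]] in auto)

section \<open>Concatenation and iterated substitution\<close>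

lemma concI: "u \<in> K \<Longrightarrow> v \<in> L \<Longrightarrow> u @ v \<in> conc K L"
  by (auto simp: conc_def)

lemma concE:
  assumes "z \<in> conc K L"
  obtains u v where "z = u @ v" "u \<in> K" "v \<in> L"
  using assms by (auto simp: conc_def)

lemma conc_assoc: "conc (conc K L) N = conc K (conc L N)"
proof (rule subset_antisym; rule subsetI)
  fix z
  assume "z \<in> conc (conc K L) N"
  then obtain x w where "z = x @ w" "x \<in> conc K L" "w \<in> N" by (rule concE)
  moreover from this obtain u v where "x = u @ v" "u \<in> K" "v \<in> L" by - (rule concE)
  ultimately show "z \<in> conc K (conc L N)"
    using concI[of u K "v @ w" "conc L N"] concI[of v L w N] by simp
next
  fix z
  assume "z \<in> conc K (conc L N)"
  then obtain u x where "z = u @ x" "u \<in> K" "x \<in> conc L N" by (rule concE)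
  moreover from this obtain v w where "x = v @ w" "v \<in> L" "w \<in> N" by - (rule concE)
  ultimately show "z \<in> conc (conc K L) N"
    using concI[of "u @ v" "conc K L" w N] concI[of u K v L] by simp
qed

lemma conc_Nil [simp]: "conc {[]} L = L"
  by (auto simp: conc_def)

lemma subst_word_append: "subst_word \<sigma> (u @ v) = conc (subst_word \<sigma> u) (subst_word \<sigma> v)"
  by (induction u) (simp_all add: conc_assoc)

lemma subst_word_subst_ext_fixed:
  "set w \<inter> B = {} \<Longrightarrow> subst_word (subst_ext B \<sigma>) w = {w}"
  by (induction w) (auto simp: subst_ext_def conc_def)

lemma iter_subst_base: "z \<in> L \<Longrightarrow> z \<in> iter_subst B \<sigma> L"
  unfolding iter_subst_def by (rule UN_I[of 0]) simp_all

lemma iter_subst_step: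
  assumes "z \<in> iter_subst B \<sigma> L" "z' \<in> subst_word (subst_ext B \<sigma>) z"
  shows "z' \<in> iter_subst B \<sigma> L"
proof -
  obtain n where "z \<in> (subst_lang (subst_ext B \<sigma>) ^^ n) L"
    using assms(1) unfolding iter_subst_def by blast
  then have "z' \<in> (subst_lang (subst_ext B \<sigma>) ^^ Suc n) L"
    using assms(2) by (auto simp: subst_lang_def)
  then show ?thesis unfolding iter_subst_def by blast
qed

lemma iter_subst_induct [consumes 1, case_names base step]:
  assumes "z \<in> iter_subst B \<sigma> L"
    and base: "\<And>z. z \<in> L \<Longrightarrow> P z"
    and step: "\<And>z z'. P z \<Longrightarrow> z' \<in> subst_word (subst_ext B \<sigma>) z \<Longrightarrow> P z'"
  shows "P z"
proof -
  have "z \<in> (subst_lang (subst_ext B \<sigma>) ^^ n) L \<Longrightarrow> P z" for n z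
    by (induction n arbitrary: z) (auto simp: subst_lang_def intro: base step)
  then show ?thesis using assms(1) unfolding iter_subst_def by blast
qed

section \<open>Invertible words\<close>

lemma word_val_cong: "(\<And>a. a \<in> set w \<Longrightarrow> \<pi> a = \<rho> a) \<Longrightarrow> word_val M \<pi> w = word_val M \<rho> w"
  by (induction w) (simp_all add: word_val_def)

text \<open>The context \<open>p\<close>, \<open>q\<close> serves the rule \<open>append\<close>:
  the two halves are replaced one after the other, each with the other half as part of its
  context.\<close>

lemma pres_cong_invariant:
  assumes "pres_cong A (special_rels ws) u v"
    and P: "\<And>p w q. w \<in> set ws \<Longrightarrow> P (p @ w @ q) \<longleftrightarrow> P (p @ q)"
  shows "P (p @ u @ q) \<longleftrightarrow> P (p @ v @ q)"
  using assms(1)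
proof (induction arbitrary: p q)
  case (base u v)
  then show ?case using P by (auto simp: special_rels_def)
next
  case (append u v u' v')
  then show ?case by (metis append.assoc)
qed auto

text \<open>Every symbol is interpreted in \<open>M\<close>, so that no alphabet has to be tracked.\<close>

locale letter_monoid = monoid M for M (structure) +
  fixes \<pi> :: "'a \<Rightarrow> 'b"
  assumes letter_closed [simp]: "\<pi> a \<in> carrier M"
begin

abbreviation val :: "'a list \<Rightarrow> 'b" where "val \<equiv> word_val M \<pi>"

lemma val_Nil [simp]: "val [] = \<one>"
  and val_Cons: "val (a # w) = \<pi> a \<otimes> val w"
  by (simp_all add: word_val_def)

lemma val_closed [simp]: "val w \<in> carrier M"
  by (induction w) (simp_all add: val_Cons)

lemma val_append [simp]: "val (u @ v) = val u \<otimes> val v"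
  by (induction u) (simp_all add: val_Cons m_assoc)

lemma val_single [simp]: "val [a] = \<pi> a"
  by (simp add: val_Cons)

lemma Units_left_factor:
  assumes "x \<in> carrier M" "y \<in> Units M" "x \<otimes> y \<in> Units M"
  shows "x \<in> Units M"
proof -
  have "x = (x \<otimes> y) \<otimes> inv y"
    using assms by (simp add: m_assoc Units_closed)
  then show ?thesis using assms by (metis Units_inv_Units Units_m_closed)
qed

lemma Units_right_factor:
  assumes "y \<in> carrier M" "x \<in> Units M" "x \<otimes> y \<in> Units M"
  shows "y \<in> Units M"
proof -
  have "y = inv x \<otimes> (x \<otimes> y)"
    using assms by (simp add: m_assoc[symmetric] Units_closed)
  then show ?thesis using assms by (metis Units_inv_Units Units_m_closed)
qed

text \<open>\<open>y\<close> has a left inverse because \<open>x \<otimes> y\<close> is a unit, and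
  a right inverse because \<open>y \<otimes> z\<close> is one. Hence it is a unit and can be
  cancelled from both products.\<close>

lemma Units_overlap:
  assumes c: "x \<in> carrier M" "y \<in> carrier M" "z \<in> carrier M"
    and "x \<otimes> y \<in> Units M" "y \<otimes> z \<in> Units M"
  shows "x \<in> Units M" "y \<in> Units M" "z \<in> Units M"
proof -
  define l where "l = inv (x \<otimes> y) \<otimes> x"
  define r where "r = z \<otimes> inv (y \<otimes> z)"
  have lr: "l \<in> carrier M" "r \<in> carrier M"
    using assms by (simp_all add: l_def r_def)
  have l: "l \<otimes> y = \<one>" using assms by (simp add: l_def m_assoc)
  have r: "y \<otimes> r = \<one>" using assms by (simp add: r_def m_assoc[symmetric])
  have "l = r" using lr l r c by (metis m_assoc l_one r_one)
  then show y: "y \<in> Units M" using l r lr c by (auto simp: Units_def)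
  show "x \<in> Units M" "z \<in> Units M"
    using Units_left_factor[OF c(1) y] Units_right_factor[OF c(3) y] assms by auto
qed

definition unit :: "'a list \<Rightarrow> bool" where "unit w \<longleftrightarrow> val w \<in> Units M"

lemma unit_overlap:
  assumes "unit (x @ y)" "unit (y @ z)"
  shows "unit x" "unit y" "unit z"
  using Units_overlap[OF val_closed val_closed val_closed, of x y z] assms
  by (simp_all add: unit_def)

lemma unit_append: "unit x \<Longrightarrow> unit y \<Longrightarrow> unit (x @ y)"
  by (simp add: unit_def)

subsection \<open>Equal words have equal decompositions\<close>

text \<open>Blocks are added on the right, which in \<open>u @ [h] @ rev v\<close> is next to
  \<open>h\<close>, where the substitution later produces them. That \<open>v'\<close> is a unit
  follows from the equation of values.\<close>

inductive decomp :: "'a list \<Rightarrow> 'a list \<Rightarrow> bool" where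
  decomp_Nil: "decomp [] []"
| decomp_unit: "decomp u v \<Longrightarrow> unit u' \<Longrightarrow> val u' = val v' \<Longrightarrow> decomp (u @ u') (v @ v')"
| decomp_letter: "decomp u v \<Longrightarrow> decomp (u @ [a]) (v @ [a])"

lemma decomp_val: "decomp u v \<Longrightarrow> val u = val v"
  by (induction rule: decomp.induct) auto

lemma decomp_refl: "decomp u u"
  by (induction u rule: rev_induct) (auto intro: decomp.intros)

lemma decomp_append:
  assumes "decomp u v" "decomp u' v'"
  shows "decomp (u @ u') (v @ v')"
  using assms(2,1)
proof (induction rule: decomp.induct)
  case (decomp_unit x y x' y')
  then show ?case using decomp.decomp_unit[of "u @ x" "v @ y"] by simp
next
  case (decomp_letter x y a)
  then show ?case using decomp.decomp_letter[of "u @ x" "v @ y"] by simp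
qed simp

lemma unit_Nil: "unit []"
  by (simp add: unit_def)

lemma decomp_of_unit: "unit g \<Longrightarrow> val g = val k \<Longrightarrow> decomp g k"
  using decomp_unit[OF decomp_Nil] by simp

text \<open>A cut of the right-hand word may fall inside a unit block, here \<open>s @ t\<close>,
  whose halves need not be units. A cut between blocks is covered by an empty block.\<close>

lemma decomp_split:
  assumes "decomp u (p @ q)"
  obtains u1 g u2 p1 s t q2 where "u = u1 @ g @ u2" "p = p1 @ s" "q = t @ q2"
    "decomp u1 p1" "unit g" "val g = val (s @ t)" "decomp u2 q2"
proof -
  let ?P = "\<lambda>u p q. \<exists>u1 g u2 p1 s t q2. u = u1 @ g @ u2 \<and> p = p1 @ s \<and> q = t @ q2 \<and>
      decomp u1 p1 \<and> unit g \<and> val g = val (s @ t) \<and> decomp u2 q2"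
  have splitI: "?P u p q"
    if "u = u1 @ g @ u2" "p = p1 @ s" "q = t @ q2"
      "decomp u1 p1" "unit g" "val g = val (s @ t)" "decomp u2 q2"
    for u p q u1 g u2 p1 s t q2
    by (intro exI conjI) (rule that)+
  have "?P u p q"
    using assms
  proof (induction u "p @ q" arbitrary: p q rule: decomp.induct)
    case decomp_Nil
    then have "[] = [] @ [] @ []" "p = [] @ []" "q = [] @ []"
      "decomp [] []" "unit []" "val [] = val ([] @ [])" "decomp [] []"
      by (simp_all add: decomp.decomp_Nil unit_Nil)
    then show ?case by (rule splitI)
  next
    case (decomp_unit u v u' v')
    from \<open>v @ v' = p @ q\<close> show ?case
    proof (cases rule: append_eq_cases)
      case inner: (gt q')
      from decomp_unit.hyps(2)[OF inner(1)]
      obtain u1 g u2 p1 s t q2 where "u = u1 @ g @ u2" "p = p1 @ s" "q' = t @ q2"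
        "decomp u1 p1" "unit g" "val g = val (s @ t)" "decomp u2 q2"
        by (elim exE conjE) (rule that)
      then have "u @ u' = u1 @ g @ (u2 @ u')" "p = p1 @ s" "q = t @ (q2 @ v')"
        "decomp u1 p1" "unit g" "val g = val (s @ t)" "decomp (u2 @ u') (q2 @ v')"
        using inner decomp.decomp_unit[OF _ decomp_unit.hyps(3,4)] by simp_all
      then show ?thesis by (rule splitI)
    next
      \<comment> \<open>The cut falls into the last unit block, so nothing remains after that
        block.\<close>
      case last: (le s)
      then have "u @ u' = u @ u' @ []" "p = v @ s" "q = q @ []"
        "decomp u v" "unit u'" "val u' = val (s @ q)" "decomp [] []"
        using decomp_unit.hyps decomp.decomp_Nil by simp_all
      then show ?thesis by (rule splitI)
    qed
  next
    case (decomp_letter u v a)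
    show ?case
    proof (cases q rule: rev_cases)
      case Nil
      then have "u @ [a] = (u @ [a]) @ [] @ []" "p = p @ []" "q = [] @ []"
        "decomp (u @ [a]) p" "unit []" "val [] = val ([] @ [])" "decomp [] []"
        using decomp.decomp_letter[OF decomp_letter.hyps(1), of a] decomp_letter.hyps(3)
        by (simp_all add: decomp.decomp_Nil unit_Nil)
      then show ?thesis by (rule splitI)
    next
      case (snoc q' b)
      then have q': "v = p @ q'" "q = q' @ [a]"
        using decomp_letter.hyps(3) by simp_all
      from decomp_letter.hyps(2)[OF q'(1)]
      obtain u1 g u2 p1 s t q2 where "u = u1 @ g @ u2" "p = p1 @ s" "q' = t @ q2"
        "decomp u1 p1" "unit g" "val g = val (s @ t)" "decomp u2 q2"
        by (elim exE conjE) (rule that)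
      then have "u @ [a] = u1 @ g @ (u2 @ [a])" "p = p1 @ s" "q = t @ (q2 @ [a])"
        "decomp u1 p1" "unit g" "val g = val (s @ t)" "decomp (u2 @ [a]) (q2 @ [a])"
        using q' decomp.decomp_letter by simp_all
      then show ?thesis by (rule splitI)
    qed
  qed
  then show thesis by (elim exE conjE) (rule that)
qed

text \<open>Insertion puts \<open>w\<close> into the block at the cut without changing its value.
  For deletion, \<open>w\<close> may begin in one unit block and end in another; the overlap
  property then allows merging these blocks, and all that lies between them, into one.\<close>

lemma decomp_insert:
  assumes w: "val w = \<one>"
  shows "decomp u (p @ w @ q) \<longleftrightarrow> decomp u (p @ q)"
proof
  assume "decomp u (p @ q)"
  then obtain u1 g u2 p1 s t q2 where "u = u1 @ g @ u2" "p = p1 @ s" "q = t @ q2"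
    "decomp u1 p1" "unit g" "val g = val (s @ t)" "decomp u2 q2"
    by (rule decomp_split)
  moreover from this have "decomp g (s @ w @ t)"
    using w by (auto intro: decomp_of_unit)
  ultimately show "decomp u (p @ w @ q)"
    using decomp_append[of u1 p1 "g @ u2" "(s @ w @ t) @ q2"]
      decomp_append[of g "s @ w @ t" u2 q2] by simp
next
  assume "decomp u (p @ w @ q)"
  then obtain u1 g u2 p1 s t y where 1: "u = u1 @ g @ u2" "p = p1 @ s" "w @ q = t @ y"
    "decomp u1 p1" "unit g" "val g = val (s @ t)" "decomp u2 y"
    by (rule decomp_split)
  \<comment> \<open>Either \<open>w\<close> lies within the block of the first cut, or it reaches
    beyond, and the rest of the word is cut again where \<open>w\<close> ends.\<close>
  from 1(3) consider (long) t' where "t = w @ t'" "q = t' @ y"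
    | (short) w' where "w = t @ w'" "y = w' @ q"
    by (auto simp: append_eq_append_conv2)
  then show "decomp u (p @ q)"
  proof cases
    case long
    then have "decomp g (s @ t')"
      using 1 w by (auto intro: decomp_of_unit)
    then show ?thesis
      using 1 long decomp_append[of u1 p1 "g @ u2" "(s @ t') @ y"]
        decomp_append[of g "s @ t'" u2 y] by simp
  next
    case short
    obtain x1 g' x2 k s' t' q2 where 2: "u2 = x1 @ g' @ x2" "w' = k @ s'" "q = t' @ q2"
      "decomp x1 k" "unit g'" "val g' = val (s' @ t')" "decomp x2 q2"
      using 1(7) unfolding short(2) by (rule decomp_split)
    have w_eq: "w = t @ k @ s'" using short 2 by simp
    have st: "unit (s @ t)" "unit (s' @ t')"
      using 1 2 by (simp_all add: unit_def)
    have "unit w" using w by (simp add: unit_def)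
    \<comment> \<open>The unit \<open>w\<close> shares \<open>t\<close> with the unit
      \<open>s @ t\<close> and \<open>s'\<close> with the unit \<open>s' @ t'\<close>, so the outer
      remainders are units.\<close>
    then have "unit s" "unit t'"
      using unit_overlap[of s t "k @ s'"] unit_overlap[of "t @ k" s' t'] st w_eq by auto
    then have u: "unit (s @ t')" by (rule unit_append)
    have "val (g @ x1 @ g') = val s \<otimes> val w \<otimes> val t'"
      using 1(6) 2(6) decomp_val[OF 2(4)] by (simp add: w_eq m_assoc)
    then have e: "val (g @ x1 @ g') = val (s @ t')"
      using w by simp
    have g: "decomp (g @ x1 @ g') (s @ t')"
      using u by (intro decomp_of_unit e) (simp add: unit_def e del: val_append)
    have "decomp (u1 @ (g @ x1 @ g') @ x2) (p1 @ (s @ t') @ q2)"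
      using decomp_append[OF 1(4) decomp_append[OF g 2(7)]] .
    then show ?thesis using 1 2 by simp
  qed
qed

text \<open>The trivial decomposition of \<open>u\<close> against itself is transported along the
  relators in its right-hand word.\<close>

lemma decomp_if_pres_cong:
  assumes "pres_cong A (special_rels ws) u v" "\<And>w. w \<in> set ws \<Longrightarrow> val w = \<one>"
  shows "decomp u v"
  using pres_cong_invariant[OF assms(1), of "decomp u" "[]" "[]"] decomp_insert assms(2)
    decomp_refl by auto

subsection \<open>Minimal invertible words take finitely many values\<close>

text \<open>Testing prefixes suffices: if a proper suffix were a unit, so would be the prefix before
  it. Units strictly inside remain possible.\<close>

definition min_unit :: "'a list \<Rightarrow> bool" where
  "min_unit m \<longleftrightarrow> m \<noteq> [] \<and> unit m \<and> (\<forall>x y. m = x @ y \<longrightarrow> x \<noteq> [] \<longrightarrow> y \<noteq> [] \<longrightarrow> \<not> unit x)"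

lemma min_unitD: "min_unit (x @ y) \<Longrightarrow> x \<noteq> [] \<Longrightarrow> y \<noteq> [] \<Longrightarrow> \<not> unit x"
  unfolding min_unit_def by blast

lemma min_unit_prefix_exists:
  assumes "unit v" "v \<noteq> []"
  obtains m v' where "v = m @ v'" "min_unit m"
proof -
  let ?P = "\<lambda>n. \<exists>m v'. v = m @ v' \<and> m \<noteq> [] \<and> unit m \<and> length m = n"
  have "?P (length v)" using assms by (intro exI[of _ v] exI[of _ "[]"]) simp
  then have "?P (LEAST n. ?P n)" by (rule LeastI)
  then obtain m v' where m: "v = m @ v'" "m \<noteq> []" "unit m" "length m = (LEAST n. ?P n)"
    by blast
  have "\<not> unit x" if "m = x @ y" "x \<noteq> []" "y \<noteq> []" for x y
  proof
    assume "unit x"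
    then have "?P (length x)" using that m(1) by (intro exI[of _ x] exI[of _ "y @ v'"]) simp
    then have "(LEAST n. ?P n) \<le> length x" by (rule Least_le)
    moreover have "length x < length m" using that by simp
    ultimately show False using m(4) by linarith
  qed
  then have "min_unit m" using m by (simp add: min_unit_def)
  then show thesis using that m(1) by blast
qed

text \<open>A unit prefix ending inside \<open>w\<close> would overlap the unit \<open>w\<close> and
  make the proper prefix \<open>m1\<close> a unit. Prefixes ending elsewhere keep their
  values.\<close>

lemma min_unit_insert:
  assumes w: "val w = \<one>" and ne: "m1 \<noteq> []" "m2 \<noteq> []"
  shows "min_unit (m1 @ w @ m2) \<longleftrightarrow> min_unit (m1 @ m2)"
proof -
  have uw: "unit (x @ w @ y) \<longleftrightarrow> unit (x @ y)" for x y
    using w by (simp add: unit_def)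
  show ?thesis
  proof
    assume m: "min_unit (m1 @ m2)"
    have "\<not> unit x" if "m1 @ w @ m2 = x @ y" "x \<noteq> []" "y \<noteq> []" for x y
    proof
      assume x: "unit x"
      have m1: "\<not> unit m1" using min_unitD[OF m] ne by blast
      from that(1) consider (in1) k where "m1 = x @ k"
        | (inw) w1 w2 where "x = m1 @ w1" "w = w1 @ w2"
        | (in2) k where "x = m1 @ w @ k" "m2 = k @ y"
        by (auto simp: append_eq_append_conv2)
      then show False
      proof cases
        case in1
        then show False using min_unitD[of x "k @ m2"] m x that ne by simp
      next
        case inw
        moreover have "unit w" using w by (simp add: unit_def)
        ultimately show False using unit_overlap(1) x m1 by blast
      next
        case in2
        then have "unit (m1 @ k)" using x uw by blast
        then show False using min_unitD[of "m1 @ k" y] m in2 ne that by simp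
      qed
    qed
    then show "min_unit (m1 @ w @ m2)"
      using m ne uw by (simp add: min_unit_def)
  next
    assume m: "min_unit (m1 @ w @ m2)"
    have "\<not> unit x" if "m1 @ m2 = x @ y" "x \<noteq> []" "y \<noteq> []" for x y
    proof
      assume x: "unit x"
      from that(1) consider (in1) k where "m1 = x @ k"
        | (in2) k where "x = m1 @ k" "m2 = k @ y"
        by (auto simp: append_eq_append_conv2)
      then show False
      proof cases
        case in1
        then show False using min_unitD[of x "k @ w @ m2"] m x that ne by simp
      next
        case in2
        then have "unit (m1 @ w @ k)" using x uw by blast
        then show False using min_unitD[of "m1 @ w @ k" y] m in2 ne that by simp
      qed
    qed
    then show "min_unit (m1 @ m2)"
      using m ne uw by (simp add: min_unit_def)
  qed
qed

text \<open>The values of minimal invertible factors of a word, up to those that occur in a relator,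
  do not change under insertion of a relator, and the empty word has none.\<close>

definition pieces_in :: "'b set \<Rightarrow> 'a list \<Rightarrow> bool" where
  "pieces_in V z \<longleftrightarrow> (\<forall>x m y. z = x @ m @ y \<longrightarrow> min_unit m \<longrightarrow> val m \<in> V)"

lemma pieces_inD: "pieces_in V (x @ m @ y) \<Longrightarrow> min_unit m \<Longrightarrow> val m \<in> V"
  unfolding pieces_in_def by blast

text \<open>A minimal unit that sticks out of \<open>w\<close> on one side only would have a proper
  unit prefix, by the overlap property. So it avoids \<open>w\<close>, lies in \<open>w\<close>, or
  sticks out on both sides, where \<open>min_unit_insert\<close> applies.\<close>

lemma pieces_in_insert:
  assumes w: "val w = \<one>" and V: "pieces_in V w"
  shows "pieces_in V (p @ w @ q) \<longleftrightarrow> pieces_in V (p @ q)"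
proof
  assume *: "pieces_in V (p @ w @ q)"
  show "pieces_in V (p @ q)"
    unfolding pieces_in_def
  proof (intro allI impI)
    fix x m y
    assume eq: "p @ q = x @ m @ y" and m: "min_unit m"
    from eq consider (inp) k where "p = x @ m @ k" | (inq) k where "q = k @ m @ y"
      | (mid) m1 m2 where "p = x @ m1" "m = m1 @ m2" "q = m2 @ y" "m1 \<noteq> []" "m2 \<noteq> []"
    proof (cases rule: append_eq_cases)
      case (le k)
      then show thesis using inq by blast
    next
      case (gt k)
      from gt(2)[symmetric] show thesis
      proof (cases rule: append_eq_cases)
        case (le l)
        then show thesis using gt mid inp[of "[]"] by (cases "l = []") auto
      next
        case (gt l)
        then show thesis using inp \<open>p = x @ k\<close> by blast
      qed
    qed
    then show "val m \<in> V"
    proof cases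
      case inp
      then show ?thesis using pieces_inD[of V x m "k @ w @ q"] * m by simp
    next
      case inq
      then show ?thesis using pieces_inD[of V "p @ w @ k" m y] * m by simp
    next
      case mid
      \<comment> \<open>A factor across the insertion point is compared with the factor enlarged by
        \<open>w\<close>, which has the same value.\<close>
      then have "min_unit (m1 @ w @ m2)" using m min_unit_insert[OF w] by blast
      then have "val (m1 @ w @ m2) \<in> V"
        using pieces_inD[of V x "m1 @ w @ m2" y] * mid by simp
      then show ?thesis using mid w by simp
    qed
  qed
next
  assume *: "pieces_in V (p @ q)"
  have uw: "unit w" using w by (simp add: unit_def)
  show "pieces_in V (p @ w @ q)"
    unfolding pieces_in_def
  proof (intro allI impI)
    fix x m y
    assume eq: "p @ w @ q = x @ m @ y" and m: "min_unit m"
    consider (inp) k where "p = x @ m @ k"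
      | (pw) m1 m2 k where "p = x @ m1" "m = m1 @ m2" "w = m2 @ k" "m1 \<noteq> []" "m2 \<noteq> []"
      | (pwq) m1 m2 where "p = x @ m1" "m = m1 @ w @ m2" "q = m2 @ y" "m1 \<noteq> []" "m2 \<noteq> []"
      | (inw) k l where "w = k @ m @ l"
      | (wq) m1 m2 k where "w = k @ m1" "m = m1 @ m2" "m1 \<noteq> []" "m2 \<noteq> []"
      | (inq) k where "q = k @ m @ y"
    proof -
      from eq show thesis
      proof (cases rule: append_eq_cases)
        case (le k)
        from le(2) show thesis
        proof (cases rule: append_eq_cases)
          case (le l)
          then show thesis using inq by blast
        next
          case gt_l: (gt l)
          from gt_l(2) show thesis
          proof (cases rule: append_eq_cases)
            case (le r)
            then show thesis using gt_l inw by blast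
          next
            case (gt r)
            then show thesis using gt_l wq by blast
          qed
        qed
      next
        case gt_k: (gt k)
        from gt_k(2) show thesis
        proof (cases rule: append_eq_cases)
          case (le r)
          then show thesis using gt_k inp by blast
        next
          case gt_r: (gt r)
          from gt_r(2)[symmetric] show thesis
          proof (cases rule: append_eq_cases)
            case (le s)
            then show thesis using gt_k gt_r pw by blast
          next
            case (gt s)
            then show thesis using gt_k gt_r pwq by blast
          qed
        qed
      qed
    qed
    then show "val m \<in> V"
    proof cases
      case inp
      then show ?thesis using pieces_inD[of V x m "k @ q"] * m by simp
    next
      case pw
      then have "unit m1"
        using unit_overlap(1)[of m1 m2 k] m uw by (simp add: min_unit_def)
      then show ?thesis using min_unitD[of m1 m2] pw m by simp
    next
      case pwq
      then have "min_unit (m1 @ m2)" using m min_unit_insert[OF w] by blast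
      then have "val (m1 @ m2) \<in> V"
        using pieces_inD[of V x "m1 @ m2" y] * pwq by simp
      then show ?thesis using pwq w by simp
    next
      case inw
      then show ?thesis using pieces_inD[of V k m l] V m by simp
    next
      case wq
      then have "unit m1"
        using unit_overlap(2)[of k m1 m2] m uw by (simp add: min_unit_def)
      then show ?thesis using min_unitD[of m1 m2] wq m by simp
    next
      case inq
      then show ?thesis using pieces_inD[of V "p @ k" m y] * m by simp
    qed
  qed
qed

lemma pieces_in_if_pres_cong_Nil:
  assumes "pres_cong A (special_rels ws) z []"
    and "\<And>w. w \<in> set ws \<Longrightarrow> val w = \<one>" "\<And>w. w \<in> set ws \<Longrightarrow> pieces_in V w"
  shows "pieces_in V z"
proof -
  have "pieces_in V []" by (simp add: pieces_in_def min_unit_def)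
  then show ?thesis
    using pres_cong_invariant[OF assms(1), of "pieces_in V" "[]" "[]"] pieces_in_insert assms(2,3)
    by simp
qed

text \<open>A shortest nonempty unit prefix is split off; the rest is again a unit by cancellation
  and inherits \<open>pieces_in\<close> as a suffix.\<close>

lemma unit_induct [consumes 2, case_names Nil piece]:
  assumes "unit v" "pieces_in V v"
    and Nil: "P []"
    and piece: "\<And>m v. unit m \<Longrightarrow> val m \<in> V \<Longrightarrow> P v \<Longrightarrow> P (m @ v)"
  shows "P v"
  using assms(1,2)
proof (induction v rule: length_induct)
  case (1 v)
  show ?case
  proof (cases "v = []")
    case True
    then show ?thesis using Nil by simp
  next
    case False
    then obtain m v' where v: "v = m @ v'" and m: "min_unit m"
      using min_unit_prefix_exists 1(2) by blast
    then have um: "unit m" "m \<noteq> []" by (auto simp: min_unit_def)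
    have "val m \<in> V" using pieces_inD[of V "[]" m v'] 1(3) v m by simp
    moreover have "unit v'" using unit_overlap(3)[of "[]" m v'] um 1(2) v by simp
    moreover have "pieces_in V v'"
      unfolding pieces_in_def using 1(3) v pieces_inD[of V "m @ _"] by auto
    ultimately show ?thesis using 1(1) v um piece by simp
  qed
qed

end

section \<open>The word problem as an iterated substitution\<close>

text \<open>The letters of \<open>X\<close> stand for the values of the invertible factors of relators.\<close>

locale special_monoid = letter_monoid M \<pi> for M (structure) and \<pi> :: "'a \<Rightarrow> 'b" +
  fixes A :: "'a set" and ws :: "'a list list" and h :: 'a and X :: "'a set"
  assumes finite_A: "finite A" and finite_X: "finite X" and h: "h \<notin> A" "h \<notin> X"
    and disjoint: "A \<inter> X = {}"
    and generated: "carrier M \<subseteq> val ` lists A"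
    and presented: "u \<in> lists A \<Longrightarrow> v \<in> lists A \<Longrightarrow> val u = val v \<Longrightarrow>
      pres_cong A (special_rels ws) u v"
    and relators: "w \<in> set ws \<Longrightarrow> val w = \<one>"
    and units_X: "x \<in> X \<Longrightarrow> \<pi> x \<in> Units M"
    and factors_X: "p @ f @ q \<in> set ws \<Longrightarrow> unit f \<Longrightarrow> val f \<in> \<pi> ` X"
begin

text \<open>Appending a word for the inverse gives a word equal to the empty one, and the factors of
  \<open>v\<close> are among its factors.\<close>

lemma unit_pieces:
  assumes "v \<in> lists A" "unit v"
  shows "pieces_in (\<pi> ` X) v"
proof -
  have "inv (val v) \<in> carrier M" using assms(2) by (simp add: unit_def)
  then obtain v' where v': "v' \<in> lists A" "val v' = inv (val v)"
    using generated by (metis imageE subsetD)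
  have "val (v @ v') = val []"
    using assms(2) v'(2) by (simp add: unit_def)
  then have "pres_cong A (special_rels ws) (v @ v') []"
    using assms(1) v'(1) by (intro presented) simp_all
  moreover have "pieces_in (\<pi> ` X) w" if "w \<in> set ws" for w
    unfolding pieces_in_def using that factors_X by (auto simp: min_unit_def)
  ultimately have "pieces_in (\<pi> ` X) (v @ v')"
    using relators pieces_in_if_pres_cong_Nil by metis
  then show ?thesis
    unfolding pieces_in_def by (metis append.assoc)
qed

definition inverse_word :: "'a \<Rightarrow> 'a list" where
  "inverse_word x = (SOME w. w \<in> lists A \<and> val w = inv (\<pi> x))"

lemma inverse_word:
  assumes "x \<in> X"
  shows "inverse_word x \<in> lists A" "val (inverse_word x) = inv (\<pi> x)"
proof -
  have "inv (\<pi> x) \<in> val ` lists A"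
    using units_X[OF assms] generated by auto
  then have "\<exists>w. w \<in> lists A \<and> val w = inv (\<pi> x)" by auto
  from someI_ex[OF this] show "inverse_word x \<in> lists A" "val (inverse_word x) = inv (\<pi> x)"
    unfolding inverse_word_def by blast+
qed

lemma mult_inv_eq_one_iff:
  assumes "x \<in> carrier M" "g \<in> Units M"
  shows "x \<otimes> inv g = \<one> \<longleftrightarrow> x = g"
proof
  assume "x \<otimes> inv g = \<one>"
  then have "x \<otimes> inv g \<otimes> g = g" using assms(2) by (simp add: Units_closed)
  then show "x = g" using assms by (simp add: m_assoc Units_closed)
qed (use assms in simp)

lemma inv_mult_Units:
  assumes a: "a \<in> Units M" and b: "b \<in> Units M"
  shows "inv (a \<otimes> b) = inv b \<otimes> inv a"
proof -
  have "(a \<otimes> b) \<otimes> (inv b \<otimes> inv a) = a \<otimes> (b \<otimes> inv b) \<otimes> inv a"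
    using a b by (simp only: m_assoc Units_closed Units_inv_closed m_closed)
  also have "\<dots> = \<one>" using a b by (simp add: Units_closed)
  finally have "(a \<otimes> b) \<otimes> (inv b \<otimes> inv a) = \<one>" .
  then show ?thesis
    using inv_unique[of "inv (a \<otimes> b)" "a \<otimes> b" "inv b \<otimes> inv a"] a b
    by (simp add: Units_closed)
qed

text \<open>Inversion reverses products and \<open>y\<close> spells its unit backwards, so inverting
  letter by letter keeps the order.\<close>

lemma inverse_hom:
  assumes "y \<in> lists X"
  shows "unit (rev y)" "hom_word inverse_word y \<in> lists A"
    "val (hom_word inverse_word y) = inv (val (rev y))"
proof -
  have "unit (rev y) \<and> hom_word inverse_word y \<in> lists A \<and>
    val (hom_word inverse_word y) = inv (val (rev y))"
    using assms
  proof (induction y)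
    case Nil
    then show ?case by (simp add: unit_Nil)
  next
    case (Cons x y)
    then have x: "\<pi> x \<in> Units M" and y: "val (rev y) \<in> Units M"
      using units_X by (simp_all add: unit_def)
    then have "inv (val (rev y) \<otimes> \<pi> x) = inv (\<pi> x) \<otimes> inv (val (rev y))"
      by (simp add: inv_mult_Units)
    then show ?case
      using Cons x y inverse_word[of x] by (simp add: unit_def)
  qed
  then show "unit (rev y)" "hom_word inverse_word y \<in> lists A"
    "val (hom_word inverse_word y) = inv (val (rev y))"
    by blast+
qed

section \<open>The substitution that generates the word problem\<close>

definition unit_pairs :: "'a list set" where
  "unit_pairs = {u @ [h] @ y | u y. u \<in> lists A \<and> y \<in> lists X \<and> val u = val (rev y)}"

lemma unit_pairsI:
  "u \<in> lists A \<Longrightarrow> y \<in> lists X \<Longrightarrow> val u = val (rev y) \<Longrightarrow> u @ [h] @ y \<in> unit_pairs"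
  unfolding unit_pairs_def by blast

text \<open>The words \<open>[h]\<close> and \<open>[c]\<close> make the substitution nested and let
  other positions rest while one is rewritten. The remaining images of \<open>h\<close> mirror the
  rules \<open>decomp_letter\<close> and \<open>decomp_unit\<close>. Only the values on
  \<open>insert h X\<close> matter, so letters of \<open>A\<close> are terminal.\<close>

definition pair_subst :: "'a \<Rightarrow> 'a list set" where
  "pair_subst c = (if c = h then {[h]} \<union> (\<lambda>a. [a, h, a]) ` A \<union> unit_pairs
    else {[c]} \<union> rev ` {v \<in> lists A. val v = \<pi> c})"

abbreviation "\<sigma> \<equiv> subst_ext (insert h X) pair_subst"

definition pair_lang :: "'a list set" where
  "pair_lang = iter_subst (insert h X) pair_subst {[h]}"

lemma subst_self: "[c] \<in> \<sigma> c"
  by (simp add: subst_ext_def pair_subst_def)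

lemma subst_word_self: "w \<in> subst_word \<sigma> w"
proof (induction w)
  case (Cons a w)
  then show ?case using concI[OF subst_self[of a]] by simp
qed simp

lemma subst_center:
  assumes "z \<in> \<sigma> h"
  shows "u @ z @ v \<in> subst_word \<sigma> (u @ [h] @ v)"
  using assms unfolding subst_word_append by (intro concI subst_word_self) (simp add: conc_def)

text \<open>By \<open>unit_pieces\<close>, each minimal unit split off by \<open>unit_induct\<close>
  has a value named by a letter of \<open>X\<close>; these letters, in reverse order, form
  \<open>y\<close>.\<close>

lemma subst_pieces:
  assumes "v \<in> lists A" "unit v"
  shows "\<exists>y\<in>lists X. rev v \<in> subst_word \<sigma> y \<and> val (rev y) = val v"
proof -
  have "v \<in> lists A \<longrightarrow> (\<exists>y\<in>lists X. rev v \<in> subst_word \<sigma> y \<and> val (rev y) = val v)"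
    using assms(2) unit_pieces[OF assms]
  proof (induction rule: unit_induct)
    case Nil
    show ?case by (auto intro!: bexI[of _ "[]"])
  next
    case (piece m v)
    show ?case
    proof
      assume mv: "m @ v \<in> lists A"
      obtain x where x: "x \<in> X" "val m = \<pi> x" using piece(2) by blast
      obtain y where y: "y \<in> lists X" "rev v \<in> subst_word \<sigma> y" "val (rev y) = val v"
        using piece(3) mv by auto
      have "rev m \<in> \<sigma> x"
        using x h mv by (auto simp: subst_ext_def pair_subst_def)
      then have "rev v @ rev m \<in> subst_word \<sigma> (y @ [x])"
        using y(2) unfolding subst_word_append by (intro concI) (simp_all add: conc_def)
      then show "\<exists>y\<in>lists X. rev (m @ v) \<in> subst_word \<sigma> y \<and> val (rev y) = val (m @ v)"
        using x y by (intro bexI[of _ "y @ [x]"]) (simp_all add: val_Cons)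
    qed
  qed
  then show ?thesis using assms(1) by blast
qed

text \<open>Each block is produced at the centre \<open>h\<close>. A common letter takes one round,
  a unit block two: first its name in letters of \<open>X\<close>, then the word itself.\<close>

lemma pair_lang_complete:
  assumes "decomp u v" "u \<in> lists A" "v \<in> lists A"
  shows "u @ [h] @ rev v \<in> pair_lang"
  using assms
proof (induction rule: decomp.induct)
  case decomp_Nil
  then show ?case by (simp add: pair_lang_def iter_subst_base)
next
  case (decomp_letter u v a)
  then have "[a, h, a] \<in> \<sigma> h"
    by (simp add: subst_ext_def pair_subst_def)
  then have "u @ [a, h, a] @ rev v \<in> subst_word \<sigma> (u @ [h] @ rev v)"
    by (rule subst_center)
  moreover have "u @ [h] @ rev v \<in> pair_lang" using decomp_letter by simp
  ultimately have "u @ [a, h, a] @ rev v \<in> pair_lang"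
    unfolding pair_lang_def using iter_subst_step by metis
  then show ?case by simp
next
  case (decomp_unit u v u' v')
  have "unit v'" using decomp_unit by (simp add: unit_def)
  then obtain y where y: "y \<in> lists X" "rev v' \<in> subst_word \<sigma> y" "val (rev y) = val v'"
    using subst_pieces[of v'] decomp_unit by auto
  have "u' @ [h] @ y \<in> unit_pairs"
    using y decomp_unit by (intro unit_pairsI) simp_all
  then have "u' @ [h] @ y \<in> \<sigma> h"
    by (simp add: subst_ext_def pair_subst_def)
  then have "u @ (u' @ [h] @ y) @ rev v \<in> subst_word \<sigma> (u @ [h] @ rev v)"
    by (rule subst_center)
  moreover have "u @ [h] @ rev v \<in> pair_lang" using decomp_unit by simp
  ultimately have "u @ (u' @ [h] @ y) @ rev v \<in> pair_lang"
    unfolding pair_lang_def using iter_subst_step by metis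
  \<comment> \<open>Second round: \<open>y\<close> becomes \<open>rev v'\<close> while all other
    letters rest.\<close>
  moreover have "(u @ u' @ [h]) @ rev v' @ rev v \<in> subst_word \<sigma> ((u @ u' @ [h]) @ y @ rev v)"
    unfolding subst_word_append[of _ "u @ u' @ [h]"] subst_word_append[of _ y]
    using y(2) by (intro concI subst_word_self)
  ultimately have "(u @ u' @ [h]) @ rev v' @ rev v \<in> pair_lang"
    unfolding pair_lang_def using iter_subst_step by (metis append.assoc)
  then show ?case by simp
qed

lemma subst_word_right:
  assumes "z \<in> subst_word \<sigma> y" "y \<in> lists (A \<union> X)"
  shows "z \<in> lists (A \<union> X) \<and> val (rev z) = val (rev y)"
  using assms
proof (induction y arbitrary: z)
  case (Cons c y)
  from Cons.prems(1) obtain z1 z2 where z: "z = z1 @ z2" "z1 \<in> \<sigma> c" "z2 \<in> subst_word \<sigma> y"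
    by (auto elim: concE)
  have "c \<noteq> h" using Cons.prems(2) h by auto
  then have "z1 \<in> lists (A \<union> X) \<and> val (rev z1) = \<pi> c"
    using z(2) Cons.prems(2) by (auto simp: subst_ext_def pair_subst_def split: if_splits)
  then show ?case using Cons z by simp
qed simp

text \<open>The part left of \<open>h\<close> is terminal, the part right of it keeps the value of
  its reversal, and an image of \<open>h\<close> adds equal values at the inner ends of both
  parts.\<close>

lemma pair_lang_sound:
  assumes "z \<in> pair_lang"
  shows "\<exists>u y. z = u @ [h] @ y \<and> u \<in> lists A \<and> y \<in> lists (A \<union> X) \<and> val u = val (rev y)"
  using assms unfolding pair_lang_def
proof (induction rule: iter_subst_induct)
  case (base z)
  then show ?case by (intro exI[of _ "[]"]) simp
next
  case (step z z')
  then obtain u y where z: "z = u @ [h] @ y" "u \<in> lists A" "y \<in> lists (A \<union> X)" "val u = val (rev y)"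
    by blast
  have "subst_word \<sigma> u = {u}"
    using z(2) h disjoint by (intro subst_word_subst_ext_fixed) auto
  then have "z' \<in> conc {u} (conc (\<sigma> h) (subst_word \<sigma> y))"
    using step(2) z(1) by (simp add: subst_word_append)
  then obtain z1 z2 where z': "z' = u @ z1 @ z2" "z1 \<in> \<sigma> h" "z2 \<in> subst_word \<sigma> y"
    by (auto elim!: concE)
  have "\<exists>u1 y1. z1 = u1 @ [h] @ y1 \<and> u1 \<in> lists A \<and> y1 \<in> lists (A \<union> X) \<and> val u1 = val (rev y1)"
  proof -
    from z'(2) consider "z1 = [] @ [h] @ []" | a where "a \<in> A" "z1 = [a] @ [h] @ [a]"
      | "z1 \<in> unit_pairs"
      by (auto simp: subst_ext_def pair_subst_def)
    then show ?thesis
    proof cases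
      case 1
      then show ?thesis by (intro exI conjI) (assumption | simp)+
    next
      case 2
      then show ?thesis by (intro exI conjI) (assumption | simp)+
    next
      case 3
      then show ?thesis unfolding unit_pairs_def by auto
    qed
  qed
  then obtain u1 y1 where z1: "z1 = u1 @ [h] @ y1" "u1 \<in> lists A" "y1 \<in> lists (A \<union> X)"
    "val u1 = val (rev y1)"
    by blast
  have "z' = (u @ u1) @ [h] @ (y1 @ z2)" using z' z1 by simp
  moreover have "u @ u1 \<in> lists A" "y1 @ z2 \<in> lists (A \<union> X)" "val (u @ u1) = val (rev (y1 @ z2))"
    using z z1 subst_word_right[OF z'(3) z(3)] by simp_all
  ultimately show ?case by blast
qed

text \<open>The intersection discards the words in which letters of \<open>X\<close> are left
  over.\<close>

lemma WP_eq: "WP M \<pi> A h = pair_lang \<inter> lists (insert h A)"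
proof (intro subset_antisym subsetI)
  fix z assume "z \<in> WP M \<pi> A h"
  then obtain u v where z: "z = u @ [h] @ rev v" "u \<in> lists A" "v \<in> lists A" "val u = val v"
    unfolding WP_def by blast
  then have "decomp u v"
    using decomp_if_pres_cong presented relators by metis
  then show "z \<in> pair_lang \<inter> lists (insert h A)"
    using z pair_lang_complete by auto
next
  fix z assume z: "z \<in> pair_lang \<inter> lists (insert h A)"
  then obtain u y where uy: "z = u @ [h] @ y" "u \<in> lists A" "y \<in> lists (A \<union> X)"
    "val u = val (rev y)"
    using pair_lang_sound by blast
  have "y \<in> lists A"
    using z uy(1,3) h disjoint by auto
  then have "z = u @ [h] @ rev (rev y)" "rev y \<in> lists A" using uy by auto
  then show "z \<in> WP M \<pi> A h"
    unfolding WP_def using uy by blast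
qed

section \<open>Membership of the constructed languages in the class\<close>

lemma IP_eq: "IP M \<pi> A = {w \<in> lists A. val w = \<one>}"
  by (simp add: IP_def)

text \<open>Erasing \<open>h\<close> and replacing letters of \<open>X\<close> by words for their
  inverses turns the equation of values into membership in the identity problem.\<close>

lemma unit_pairs_in:
  assumes "AFL C" "IP M \<pi> A \<in> C"
  shows "unit_pairs \<in> C"
proof -
  let ?\<phi> = "\<lambda>c. if c \<in> A then [c] else if c = h then [] else inverse_word c"
  let ?N = "{z \<in> lists (insert h (A \<union> X)). hom_word ?\<phi> z \<in> IP M \<pi> A} \<inter> split_at A h X"
  have iff: "hom_word ?\<phi> (u @ [h] @ y) \<in> IP M \<pi> A \<longleftrightarrow> val u = val (rev y)"
    if u: "u \<in> lists A" and y: "y \<in> lists X" for u y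
  proof -
    have "hom_word ?\<phi> u = u" using u by (intro hom_word_id) auto
    moreover have "hom_word ?\<phi> y = hom_word inverse_word y"
      using y h disjoint by (intro hom_word_cong) auto
    ultimately have "hom_word ?\<phi> (u @ [h] @ y) = u @ hom_word inverse_word y"
      using h by simp
    then show ?thesis
      using inverse_hom[OF y] u mult_inv_eq_one_iff by (simp add: IP_eq unit_def)
  qed
  have "?N = unit_pairs"
  proof (intro subset_antisym subsetI)
    fix z assume "z \<in> ?N"
    then show "z \<in> unit_pairs"
      unfolding unit_pairs_def split_at_def using iff by blast
  next
    fix z assume "z \<in> unit_pairs"
    then obtain u y where z: "z = u @ [h] @ y" "u \<in> lists A" "y \<in> lists X" "val u = val (rev y)"
      unfolding unit_pairs_def by blast
    have "hom_word ?\<phi> z \<in> IP M \<pi> A" "z \<in> split_at A h X"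
      unfolding z(1) using iff[OF z(2,3)] z(4) split_atI[OF z(2,3)] by blast+
    then show "z \<in> ?N" using z by auto
  qed
  moreover have "?N \<in> C"
    using assms finite_A finite_X h regular_split_at[of A X h]
    by (intro AFL_regular[OF assms(1)] AFL_inverse_hom[OF assms(1)]) simp_all
  ultimately show ?thesis by simp
qed

lemma pair_subst_in:
  assumes "AFL C" "closed_reversal C" "IP M \<pi> A \<in> C" "c \<in> insert h X"
  shows "pair_subst c \<in> C"
proof -
  have Nil: "[] \<in> IP M \<pi> A" by (simp add: IP_eq)
  note finite_union = AFL_finite_union[OF assms(1,3) Nil]
  show ?thesis
  proof (cases "c = h")
    case True
    then show ?thesis
      using finite_union[of "{[h]} \<union> (\<lambda>a. [a, h, a]) ` A" unit_pairs] finite_A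
        unit_pairs_in[OF assms(1,3)] by (simp add: pair_subst_def)
  next
    case False
    then have c: "c \<in> X" using assms(4) by simp
    \<comment> \<open>The representatives of an invertible element form a right quotient of the
      identity problem.\<close>
    have "{v \<in> lists A. val v = \<pi> c} = {v \<in> lists A. v @ inverse_word c \<in> IP M \<pi> A}"
      using inverse_word[OF c] units_X[OF c] mult_inv_eq_one_iff by (auto simp: IP_eq)
    then have "{v \<in> lists A. val v = \<pi> c} \<in> C"
      using AFL_right_quotient[OF assms(1,3) finite_A h(1)] by simp
    \<comment> \<open>This is where closure under reversal enters.\<close>
    then have "rev ` {v \<in> lists A. val v = \<pi> c} \<in> C"
      using assms(2) by (simp add: closed_reversal_def)
    then show ?thesis
      using finite_union[of "{[c]}"] False by (simp add: pair_subst_def)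
  qed
qed

lemma WP_in:
  assumes "super_AFL C" "closed_reversal C" "IP M \<pi> A \<in> C"
  shows "WP M \<pi> A h \<in> C"
proof -
  have C: "AFL C" "closed_nested_iter_subst C"
    using assms(1) by (simp_all add: super_AFL_def)
  have Nil: "[] \<in> IP M \<pi> A" by (simp add: IP_eq)
  have "pair_lang \<in> C"
    unfolding pair_lang_def
  proof (rule C(2)[unfolded closed_nested_iter_subst_def, rule_format])
    show "finite (insert h X)" using finite_X by simp
    show "pair_subst c \<in> C" if "c \<in> insert h X" for c
      using pair_subst_in[OF C(1) assms(2,3) that] .
    show "nested_subst (insert h X) pair_subst"
      by (simp add: nested_subst_def subst_self)
    show "{[h]} \<in> C" by (rule AFL_letter[OF C(1) assms(3) Nil])
    show "{[h]} \<subseteq> lists (insert h X)" by simp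
  qed
  then show ?thesis
    unfolding WP_eq using AFL_restrict[OF C(1)] finite_A by simp
qed

end

section \<open>Equivalence of the three conditions\<close>

lemma finite_factors: "finite {f. \<exists>w\<in>set ws. \<exists>p q. w = p @ f @ q}"
proof -
  have "{f. \<exists>w\<in>set ws. \<exists>p q. w = p @ f @ q} \<subseteq> (\<Union>w\<in>set ws. {f. sublist f w})"
    by (auto simp: sublist_def)
  then show ?thesis by (rule finite_subset) (simp add: set_sublists_eq[symmetric])
qed

theorem theorem3p2:
  fixes M :: "('m, 'x) monoid_scheme" and \<pi> :: "'a \<Rightarrow> 'm"
    and A :: "'a set" and ws :: "'a list list" and h :: 'a
    and C :: "'a list set set"
  assumes "infinite (UNIV :: 'a set)"
    and "finite A" and "set ws \<subseteq> lists A" and "h \<notin> A"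
    and "presented_by M \<pi> A (special_rels ws)"
    and "super_AFL C" and "closed_reversal C"
  shows "(WP M \<pi> A h \<in> C \<longleftrightarrow> (\<forall>w\<in>lists A. Rep M \<pi> A w \<in> C)) \<and>
         ((\<forall>w\<in>lists A. Rep M \<pi> A w \<in> C) \<longleftrightarrow> IP M \<pi> A \<in> C)"
proof -
  have AFL: "AFL C" using assms(6) by (simp add: super_AFL_def)
  have M: "monoid M" and \<pi>: "\<pi> ` A \<subseteq> carrier M" and onto: "word_val M \<pi> ` lists A = carrier M"
    and kernel: "\<And>u v. u \<in> lists A \<Longrightarrow> v \<in> lists A \<Longrightarrow>
      word_val M \<pi> u = word_val M \<pi> v \<longleftrightarrow> pres_cong A (special_rels ws) u v"
    using assms(5) by (simp_all add: presented_by_def)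
  have WP_Rep: "Rep M \<pi> A w \<in> C" if WP: "WP M \<pi> A h \<in> C" and w: "w \<in> lists A" for w
  proof -
    have "u @ [h] @ rev w \<in> WP M \<pi> A h \<longleftrightarrow> word_val M \<pi> u = word_val M \<pi> w" if "u \<in> lists A" for u
    proof
      assume "u @ [h] @ rev w \<in> WP M \<pi> A h"
      then obtain u' v where "u @ h # rev w = u' @ h # rev v" "word_val M \<pi> u' = word_val M \<pi> v"
        by (auto simp: WP_def)
      \<comment> \<open>The splitting at \<open>h\<close> is unique, as \<open>h\<close> occurs
        neither in \<open>u\<close> nor in \<open>w\<close>.\<close>
      moreover have "h \<notin> set u" "h \<notin> set (rev w)"
        using w that assms(4) by auto
      ultimately show "word_val M \<pi> u = word_val M \<pi> w"
        by (simp add: append_Cons_eq_iff)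
    qed (use w that in \<open>auto simp: WP_def\<close>)
    then have "Rep M \<pi> A w = {u \<in> lists A. u @ ([h] @ rev w) \<in> WP M \<pi> A h}"
      by (auto simp: Rep_def)
    then show ?thesis
      using AFL_right_quotient[OF AFL WP assms(2,4), of "[h] @ rev w"] by simp
  qed
  have Rep_IP: "IP M \<pi> A = Rep M \<pi> A []"
    by (simp add: IP_def Rep_def word_val_def)
  have IP_WP: "WP M \<pi> A h \<in> C" if IP: "IP M \<pi> A \<in> C"
  proof -
    define F where
      "F = {f. \<exists>w\<in>set ws. \<exists>p q. w = p @ f @ q} \<inter> {f. word_val M \<pi> f \<in> Units M}"
    \<comment> \<open>The infinite supply of symbols yields one fresh letter for each invertible
      factor of a relator.\<close>
    have "infinite (UNIV - insert h A)" using assms(1,2) by simp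
    then obtain X where X: "finite X" "card X = card F" "X \<subseteq> UNIV - insert h A"
      using infinite_arbitrarily_large by blast
    obtain factor where factor: "bij_betw factor X F"
      using finite_same_card_bij[OF X(1) _ X(2)] finite_factors[of ws] by (auto simp: F_def)
    \<comment> \<open>\<open>\<rho>\<close> agrees with \<open>\<pi>\<close> on \<open>A\<close> and
      sends each fresh letter to its unit. The default \<open>\<one>\<close> interprets all other
      symbols, including \<open>h\<close>, as \<open>letter_monoid\<close> demands.\<close>
    define \<rho> where "\<rho> c = (if c \<in> A then \<pi> c
      else if c \<in> X then word_val M \<pi> (factor c) else \<one>\<^bsub>M\<^esub>)" for c
    have \<rho>: "word_val M \<rho> w = word_val M \<pi> w" if "w \<in> lists A" for w
      using that by (intro word_val_cong) (auto simp: \<rho>_def)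
    have X_Units: "\<rho> x \<in> Units M" if "x \<in> X" for x
      using bij_betwE[OF factor] that X(3) by (auto simp: \<rho>_def F_def)
    interpret monoid M by (rule M)
    interpret letter_monoid M \<rho>
    proof
      show "\<rho> a \<in> carrier M" for a
        using \<pi> X_Units[of a] by (cases "a \<in> X") (auto simp: \<rho>_def)
    qed
    interpret special_monoid M \<rho> A ws h X
    proof
      show "finite A" "finite X" "h \<notin> A" "h \<notin> X" "A \<inter> X = {}"
        using assms(2,4) X by auto
      show "carrier M \<subseteq> word_val M \<rho> ` lists A"
        using onto \<rho> by (metis image_cong order_refl)
      show "pres_cong A (special_rels ws) u v"
        if "u \<in> lists A" "v \<in> lists A" "word_val M \<rho> u = word_val M \<rho> v" for u v
        using that \<rho> kernel by metis
      show "word_val M \<rho> w = \<one>\<^bsub>M\<^esub>" if "w \<in> set ws" for w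
      proof -
        have "pres_cong A (special_rels ws) w []"
          using that by (intro pres_cong.base) (auto simp: special_rels_def)
        moreover have "w \<in> lists A" using that assms(3) by blast
        ultimately show ?thesis
          using kernel[of w "[]"] \<rho> by (simp add: word_val_def)
      qed
      show "\<rho> x \<in> Units M" if "x \<in> X" for x
        by (rule X_Units[OF that])
      show "word_val M \<rho> f \<in> \<rho> ` X" if "p @ f @ q \<in> set ws" "unit f" for p f q
      proof -
        have f: "f \<in> lists A" using that(1) assms(3) by auto
        then have "f \<in> F"
          using that \<rho>[OF f] unfolding F_def unit_def by auto
        then obtain x where "x \<in> X" "factor x = f"
          using factor by (auto simp: bij_betw_def)
        moreover from this have "\<rho> x = word_val M \<pi> f"
          using X(3) by (auto simp: \<rho>_def)
        ultimately show ?thesis using \<rho>[OF f] by force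
      qed
    qed
    have "IP M \<rho> A = IP M \<pi> A"
      unfolding IP_def by (intro Collect_cong conj_cong) (simp_all only: \<rho>)
    moreover have "WP M \<rho> A h = WP M \<pi> A h"
      unfolding WP_def by (intro Collect_cong ex_cong1 conj_cong) (simp_all only: \<rho>)
    ultimately show ?thesis
      using WP_in[OF assms(6,7)] IP by simp
  qed
  show ?thesis
    using WP_Rep Rep_IP IP_WP by auto
qed

end
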